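(* Let $N\geq 2$, $b>0$, and $1<p<1+\frac{2b}{N-1}$. Then $$\sup\left\{\frac{\displaystyle\int_{\mathbb R^N}|x|^b|f(x)|^{p+1}\,dx}{\|f\|_{H^1}^{p+1}}\ :\ f\in H^1(\mathbb R^N)\setminus\{0\}\right\}=\infty.$$ *)

theory Defs
  imports "HOL-Analysis.Analysis"
begin

(* The domain is a Euclidean space 'a of dimension N = DIM('a) with its Lebesgue measure;
   functions take values in a Euclidean space 'k (later a normed field, i.e. the reals or
   the complex numbers). *)

primrec Ck :: "nat \<Rightarrow> ('a::euclidean_space \<Rightarrow> real) \<Rightarrow> bool" where
  "Ck 0 f \<longleftrightarrow> continuous_on UNIV f"
| "Ck (Suc k) f \<longleftrightarrow> f differentiable_on UNIV \<and>
     (\<forall>i\<in>Basis. Ck k (\<lambda>x. frechet_derivative f (at x) i))"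

definition test_function :: "('a::euclidean_space \<Rightarrow> real) \<Rightarrow> bool" where
  "test_function \<phi> \<longleftrightarrow> (\<forall>k. Ck k \<phi>) \<and> compact (closure {x. \<phi> x \<noteq> 0})"

definition locally_integrable :: "('a::euclidean_space \<Rightarrow> 'k::euclidean_space) \<Rightarrow> bool" where
  "locally_integrable f \<longleftrightarrow> (\<forall>K. compact K \<longrightarrow> set_integrable lebesgue K f)"

definition has_weak_partial ::
  "'a::euclidean_space \<Rightarrow> ('a \<Rightarrow> 'k::euclidean_space) \<Rightarrow> ('a \<Rightarrow> 'k) \<Rightarrow> bool" where
  "has_weak_partial i f g \<longleftrightarrow> locally_integrable f \<and> locally_integrable g \<and>
     (\<forall>\<phi>. test_function \<phi> \<longrightarrow>
        (LINT x|lebesgue. frechet_derivative \<phi> (at x) i *\<^sub>R f x) =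
        - (LINT x|lebesgue. \<phi> x *\<^sub>R g x))"

(* A weak partial derivative is unique only up to null sets; this picks a representative. *)
definition weak_partial ::
  "'a::euclidean_space \<Rightarrow> ('a \<Rightarrow> 'k::euclidean_space) \<Rightarrow> 'a \<Rightarrow> 'k" where
  "weak_partial i f = (SOME g. has_weak_partial i f g)"

definition L2 :: "('a::euclidean_space \<Rightarrow> 'k::euclidean_space) set" where
  "L2 = {f. f \<in> borel_measurable lebesgue \<and> integrable lebesgue (\<lambda>x. (norm (f x))\<^sup>2)}"

(* Elements are functions rather than classes modulo equality almost everywhere, so the zero
   element of the Sobolev space corresponds to the functions that vanish almost everywhere. *)
definition H1 :: "('a::euclidean_space \<Rightarrow> 'k::euclidean_space) set" where
  "H1 = {f \<in> L2. \<forall>i\<in>Basis. \<exists>g\<in>L2. has_weak_partial i f g}"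

definition H1_norm :: "('a::euclidean_space \<Rightarrow> 'k::euclidean_space) \<Rightarrow> real" where
  "H1_norm f = sqrt ((LINT x|lebesgue. (norm (f x))\<^sup>2) +
     (\<Sum>i\<in>Basis. LINT x|lebesgue. (norm (weak_partial i f x))\<^sup>2))"

end

theory Submission
  imports Defs
begin

text \<open>
  The weight \<open>|x|\<^sup>b\<close> rewards mass far from the origin, so the quotient is tested on functions that
  live on a spherical shell of radius \<open>R\<close> and thickness of order one.  With \<open>N\<close> the dimension and
  \<open>d = N - 1\<close>, such a shell has volume of order \<open>R powr d\<close>.  If the functions and
  their gradients are bounded uniformly in \<open>R\<close>, and the functions are bounded below on a smaller
  shell of comparable volume, then the numerator is at least of order \<open>R powr (b + d)\<close>, while
  the Sobolev norm is at most of order \<open>R powr (d / 2)\<close>.  Hence the quotient is at least a fixed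
  positive multiple of \<open>R powr e\<close> with \<open>e = b + d - d * (p + 1) / 2 = b - d * (p - 1) / 2\<close>, and
  the upper bound on \<open>p\<close> says exactly that \<open>e > 0\<close>.  Letting \<open>R\<close> grow gives the claim.

  The test functions are \<open>shell_bump R\<close>, the smooth cutoff \<open>t \<mapsto> exp (- 1 / t)\<close> evaluated at
  \<open>1 - s\<^sup>2\<close> with \<open>s = (|x|\<^sup>2 - R\<^sup>2) / R\<close>.  Using \<open>|x|\<^sup>2\<close> in place of \<open>|x|\<close> keeps them
  smooth at the origin, and division by \<open>R\<close> makes the thickness in \<open>|x|\<close> of order one.

  Since the Sobolev norm is defined through an arbitrarily chosen weak derivative, an upper bound
  for it rests on two facts.  The classical partial derivatives are weak ones
  (\<open>has_weak_partial_C1\<close>): the integral of a partial derivative of a compactly supported function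
  vanishes, because Lebesgue measure is translation invariant.  And weak derivatives are unique
  almost everywhere (\<open>has_weak_partial_unique_AE\<close>): smooth bumps converge to indicators of boxes, so
  a locally integrable function orthogonal to all test functions has integral zero over every box
  and vanishes almost everywhere by the Lebesgue differentiation theorem.
\<close>

section \<open>Algebra of functions of class Ck\<close>
lemma Ck_Suc_imp_Ck: "Ck (Suc k) f \<Longrightarrow> Ck k f"
proof (induction k arbitrary: f)
  case 0
  then show ?case by (simp add: differentiable_imp_continuous_on)
next
  case (Suc k)
  from Suc.prems have "f differentiable_on UNIV"
    "\<forall>i\<in>Basis. Ck (Suc k) (\<lambda>x. frechet_derivative f (at x) i)"
    by simp_all
  with Suc.IH show ?case by simp
qed

lemma Ck_SucI:
  assumes "\<And>x. (f has_derivative f' x) (at x)" "\<And>i. i \<in> Basis \<Longrightarrow> Ck k (\<lambda>x. f' x i)"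
  shows "Ck (Suc k) f"
proof -
  have "frechet_derivative f (at x) = f' x" for x
    using frechet_derivative_at[OF assms(1)] by simp
  moreover have "f differentiable_on UNIV"
    unfolding differentiable_on_def differentiable_def using assms(1) by blast
  ultimately show ?thesis using assms(2) by simp
qed

lemma Ck_Suc_has_derivative:
  "Ck (Suc k) f \<Longrightarrow> (f has_derivative frechet_derivative f (at x)) (at x)"
  by (auto simp: differentiable_on_def frechet_derivative_works)

lemma Ck_const: "Ck k (\<lambda>x. c)"
proof (induction k arbitrary: c)
  case (Suc k)
  show ?case by (rule Ck_SucI[OF has_derivative_const Suc])
qed simp

lemma Ck_add: "Ck k f \<Longrightarrow> Ck k g \<Longrightarrow> Ck k (\<lambda>x. f x + g x)"
proof (induction k arbitrary: f g)
  case 0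
  then show ?case by (simp add: continuous_on_add)
next
  case (Suc k)
  show ?case
    by (rule Ck_SucI[OF has_derivative_add[OF Suc.prems[THEN Ck_Suc_has_derivative]]])
       (use Suc in simp)
qed

lemma Ck_mult: "Ck k f \<Longrightarrow> Ck k g \<Longrightarrow> Ck k (\<lambda>x. f x * g x)"
proof (induction k arbitrary: f g)
  case 0
  then show ?case by (simp add: continuous_on_mult)
next
  case (Suc k)
  note low = Suc.prems[THEN Ck_Suc_imp_Ck]
  show ?case
    by (rule Ck_SucI[OF has_derivative_mult[OF Suc.prems[THEN Ck_Suc_has_derivative]]])
       (use Suc low in \<open>auto intro!: Ck_add Suc.IH\<close>)
qed

lemma Ck_prod: "(\<And>i. i \<in> I \<Longrightarrow> Ck k (f i)) \<Longrightarrow> Ck k (\<lambda>x. \<Prod>i\<in>I. f i x)"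
  by (induction I rule: infinite_finite_induct) (auto intro: Ck_const Ck_mult)

section \<open>The flat exponential\<close>

text \<open>For \<open>p = 1\<close> this is the standard smooth function that is flat at \<open>0\<close>.  The
  polynomial factor makes the family closed under differentiation, so that smoothness follows by
  a single induction over all \<open>p\<close>.\<close>
definition flat_exp :: "real poly \<Rightarrow> real \<Rightarrow> real" where
  "flat_exp p t = (if t > 0 then poly p (1 / t) * exp (- (1 / t)) else 0)"

lemma poly_times_exp_minus_tendsto_0:
  fixes p :: "real poly"
  shows "((\<lambda>y. poly p y * exp (- y)) \<longlongrightarrow> 0) at_top"
proof -
  have "((\<lambda>y. \<Sum>i\<le>degree p. coeff p i * (y ^ i / exp y)) \<longlongrightarrow> (\<Sum>i\<le>degree p. coeff p i * 0)) at_top"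
    by (intro tendsto_intros tendsto_power_div_exp_0)
  then show ?thesis
    by (simp add: poly_altdef sum_distrib_right exp_minus divide_inverse mult.assoc)
qed

text \<open>For positive \<open>t\<close> the chain rule gives
  \<open>(P (1/t) - P' (1/t)) / t\<^sup>2 * exp (-1/t)\<close>, which is again of the same form.  At \<open>0\<close> the difference
  quotient is \<open>y * P y * exp (- y)\<close> with \<open>y = 1 / t\<close>, and the exponential beats the polynomial.\<close>
lemma flat_exp_has_derivative:
  "(flat_exp p has_real_derivative flat_exp ([:0, 0, 1:] * (p - pderiv p)) t) (at t)"
proof -
  consider "t < 0" | "t = 0" | "t > 0" by linarith
  then show ?thesis
  proof cases
    case 1
    have "((\<lambda>_. 0) has_real_derivative 0) (at t)" by simp
    then have "(flat_exp p has_real_derivative 0) (at t)"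
      by (rule DERIV_cong_ev[THEN iffD1, rotated -1])
         (use 1 in \<open>auto simp: flat_exp_def intro!: eventually_mono[OF order_tendstoD(2)[OF tendsto_ident_at]] eventually_nhds_in_open[of "{..<0}" t, THEN eventually_mono]\<close>)
    then show ?thesis using 1 by (simp add: flat_exp_def)
  next
    case 2
    have "((\<lambda>h. flat_exp p h / h) \<longlongrightarrow> 0) (at_right 0)"
    proof -
      have "((\<lambda>h. poly ([:0,1:] * p) (inverse h) * exp (- inverse h)) \<longlongrightarrow> 0) (at_right (0::real))"
        by (rule filterlim_compose[OF poly_times_exp_minus_tendsto_0 filterlim_inverse_at_top_right])
      then show ?thesis
        by (rule Lim_transform_eventually)
           (auto simp: eventually_at_filter flat_exp_def divide_inverse)
    qed
    moreover have "((\<lambda>h. flat_exp p h / h) \<longlongrightarrow> 0) (at_left 0)"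
      by (rule Lim_transform_eventually[OF tendsto_const])
         (auto simp: eventually_at_filter flat_exp_def)
    ultimately have "((\<lambda>h. flat_exp p h / h) \<longlongrightarrow> 0) (at 0)"
      by (simp add: filterlim_split_at)
    then show ?thesis using 2 by (simp add: DERIV_def flat_exp_def)
  next
    case 3
    have "((\<lambda>t. poly p (1 / t) * exp (- (1 / t))) has_real_derivative
       flat_exp ([:0, 0, 1:] * (p - pderiv p)) t) (at t)"
      by (rule derivative_eq_intros poly_DERIV[THEN DERIV_chain2] refl | use 3 in force)+
         (use 3 in \<open>simp add: flat_exp_def field_simps power2_eq_square\<close>)
    then show ?thesis
      by (rule DERIV_cong_ev[THEN iffD1, rotated -1])
         (use 3 in \<open>auto simp: flat_exp_def intro!: eventually_nhds_in_open[of "{0<..}" t, THEN eventually_mono]\<close>)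
  qed
qed

lemma continuous_flat_exp: "continuous_on UNIV (flat_exp p)"
  by (meson DERIV_isCont continuous_at_imp_continuous_on flat_exp_has_derivative)

lemma Ck_flat_exp: "Ck k (\<lambda>x. flat_exp p (x \<bullet> v + c))"
proof (induction k arbitrary: p)
  case 0
  show ?case
    by (auto intro!: continuous_intros continuous_on_compose2[OF continuous_flat_exp])
next
  case (Suc k)
  show ?case
  proof (rule Ck_SucI)
    fix x
    show "((\<lambda>x. flat_exp p (x \<bullet> v + c)) has_derivative
       (\<lambda>h. flat_exp ([:0, 0, 1:] * (p - pderiv p)) (x \<bullet> v + c) * (h \<bullet> v))) (at x)"
      by (rule has_derivative_eq_rhs[OF has_derivative_compose[OF _ flat_exp_has_derivative[unfolded has_field_derivative_def], of "\<lambda>x. x \<bullet> v + c"]])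
         (auto intro!: derivative_eq_intros)
  qed (intro Ck_mult Suc.IH Ck_const)
qed

section \<open>Bump functions approximating boxes\<close>
lemma flat_exp_1_bounds: "0 \<le> flat_exp 1 t" "flat_exp 1 t \<le> 1"
  by (auto simp: flat_exp_def)

text \<open>Scaling the argument of the flat exponential is a smooth regularisation of the Heaviside
  function with values in the unit interval, so no separate mollifier is needed.\<close>
lemma flat_exp_1_scale_tendsto:
  "(\<lambda>n. flat_exp 1 (real (Suc n) * t)) \<longlonglongrightarrow> (if t > 0 then 1 else 0)"
proof (cases "t > 0")
  case True
  have "(\<lambda>n. exp (- (inverse (real (Suc n)) * (1 / t)))) \<longlonglongrightarrow> exp (- (0 * (1 / t)))"
    by (intro tendsto_intros LIMSEQ_inverse_real_of_nat)
  moreover have "exp (- (inverse (real (Suc n)) * (1 / t))) = flat_exp 1 (real (Suc n) * t)" for n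
  proof -
    have "0 < real (Suc n) * t" using True by simp
    then show ?thesis by (simp add: flat_exp_def divide_inverse del: of_nat_Suc)
  qed
  ultimately show ?thesis using True by simp
next
  case False
  then have "flat_exp 1 (real (Suc n) * t) = 0" for n
    by (simp add: flat_exp_def zero_less_mult_iff)
  then show ?thesis using False by simp
qed

definition box_bump :: "'a::euclidean_space \<Rightarrow> 'a \<Rightarrow> nat \<Rightarrow> 'a \<Rightarrow> real" where
  "box_bump a b n x = (\<Prod>i\<in>Basis.
     flat_exp 1 (real (Suc n) * ((x - a) \<bullet> i)) * flat_exp 1 (real (Suc n) * ((b - x) \<bullet> i)))"

lemma box_bump_bounds: "0 \<le> box_bump a b n x" "box_bump a b n x \<le> 1"
  unfolding box_bump_def
  by (auto intro!: prod_nonneg prod_le_1 mult_nonneg_nonneg mult_le_one flat_exp_1_bounds)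

lemma box_bump_eq_0:
  fixes x :: "'a::euclidean_space"
  assumes "x \<notin> box a b"
  shows "box_bump a b n x = 0"
proof -
  obtain i :: 'a where i: "i \<in> Basis" "\<not> (a \<bullet> i < x \<bullet> i \<and> x \<bullet> i < b \<bullet> i)"
    using assms by (auto simp: mem_box)
  then have "(x - a) \<bullet> i \<le> 0 \<or> (b - x) \<bullet> i \<le> 0" by (auto simp: inner_diff_left)
  then have "flat_exp 1 (real (Suc n) * ((x - a) \<bullet> i)) * flat_exp 1 (real (Suc n) * ((b - x) \<bullet> i)) = 0"
    by (auto simp: flat_exp_def zero_less_mult_iff)
  with i show ?thesis unfolding box_bump_def by (intro prod_zero) auto
qed

lemma box_bump_tendsto_indicator:
  fixes x :: "'a::euclidean_space"
  shows "(\<lambda>n. box_bump a b n x) \<longlonglongrightarrow> indicator (box a b) x"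
proof (cases "x \<in> box a b")
  case True
  have "(\<lambda>n. box_bump a b n x) \<longlonglongrightarrow> (\<Prod>i\<in>(Basis::'a set).
      (if (x - a) \<bullet> i > 0 then 1 else 0) * (if (b - x) \<bullet> i > 0 then 1 else 0))"
    unfolding box_bump_def by (intro tendsto_prod tendsto_mult flat_exp_1_scale_tendsto)
  also have "(\<Prod>i\<in>(Basis::'a set).
      (if (x - a) \<bullet> i > 0 then 1 else 0) * (if (b - x) \<bullet> i > 0 then 1 else 0)) = (1::real)"
    using True by (intro prod.neutral) (auto simp: mem_box inner_diff_left)
  finally show ?thesis using True by simp
qed (simp add: box_bump_eq_0)

lemma test_function_box_bump:
  fixes a b :: "'a::euclidean_space"
  shows "test_function (box_bump a b n)"
  unfolding test_function_def
proof
  have "Ck k (\<lambda>x::'a. \<Prod>i\<in>Basis.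
      flat_exp 1 (x \<bullet> (real (Suc n) *\<^sub>R i) + (- (real (Suc n) * (a \<bullet> i)))) *
      flat_exp 1 (x \<bullet> (- real (Suc n) *\<^sub>R i) + real (Suc n) * (b \<bullet> i)))" for k
    by (intro Ck_prod Ck_mult Ck_flat_exp)
  moreover have "box_bump a b n = (\<lambda>x::'a. \<Prod>i\<in>Basis.
      flat_exp 1 (x \<bullet> (real (Suc n) *\<^sub>R i) + (- (real (Suc n) * (a \<bullet> i)))) *
      flat_exp 1 (x \<bullet> (- real (Suc n) *\<^sub>R i) + real (Suc n) * (b \<bullet> i)))"
    unfolding box_bump_def
    by (intro ext prod.cong refl arg_cong2[where f="(*)"] arg_cong[where f="flat_exp 1"])
       (simp_all add: inner_diff_left algebra_simps)
  ultimately show "\<forall>k. Ck k (box_bump a b n)" by simp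
  have "{x. box_bump a b n x \<noteq> 0} \<subseteq> box a b" using box_bump_eq_0 by blast
  then show "compact (closure {x. box_bump a b n x \<noteq> 0})"
    by (meson bounded_box bounded_subset compact_closure)
qed

section \<open>Uniqueness of weak derivatives\<close>

text \<open>By Lebesgue differentiation, almost every value is the limit of averages over
  shrinking cubes, and all these averages are zero.\<close>
lemma integral_cbox_eq_0_AE:
  fixes h :: "'a::euclidean_space \<Rightarrow> 'b::euclidean_space"
  assumes "\<And>a b. (h has_integral 0) (cbox a b)"
  shows "AE x in lebesgue. h x = 0"
proof -
  have "h integrable_on cbox a b" for a b using assms by blast
  then obtain N where N: "negligible N"
    "\<And>x e. \<lbrakk>x \<notin> N; 0 < e\<rbrakk> \<Longrightarrow> \<exists>d>0. \<forall>t. 0 < t \<and> t < d \<longrightarrow>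
       norm (integral (cbox x (x + t *\<^sub>R One)) h /\<^sub>R t ^ DIM('a) - h x) < e"
    using integrable_ccontinuous_explicit by metis
  have "h x = 0" if "x \<notin> N" for x
  proof -
    have "norm (h x) < e" if e: "0 < e" for e
    proof -
      obtain d where "d > 0" "\<forall>t. 0 < t \<and> t < d \<longrightarrow>
         norm (integral (cbox x (x + t *\<^sub>R One)) h /\<^sub>R t ^ DIM('a) - h x) < e"
        using N(2)[OF \<open>x \<notin> N\<close> e] by blast
      then have "norm (integral (cbox x (x + (d/2) *\<^sub>R One)) h /\<^sub>R (d/2) ^ DIM('a) - h x) < e"
        by simp
      then show ?thesis using integral_unique[OF assms] by simp
    qed
    then show ?thesis by (meson less_irrefl zero_less_norm_iff)
  qed
  then show ?thesis
    using N(1) by (intro AE_I'[of N]) (auto simp: negligible_iff_null_sets)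
qed

text \<open>The fundamental lemma of the calculus of variations.  Pairing with \<open>box_bump a b n\<close> and
  letting \<open>n\<close> tend to infinity shows that the integral over every box is zero.\<close>
lemma AE_0_if_orthogonal_to_test_functions:
  fixes h :: "'a::euclidean_space \<Rightarrow> 'b::euclidean_space"
  assumes h: "locally_integrable h"
    and orth: "\<And>\<phi>. test_function \<phi> \<Longrightarrow> (LINT x|lebesgue. \<phi> x *\<^sub>R h x) = 0"
  shows "AE x in lebesgue. h x = 0"
proof (rule integral_cbox_eq_0_AE)
  fix a b :: 'a
  \<comment> \<open>Cutting off to the closed box gives a globally integrable function; the bumps vanish outside
    the box, so their pairings do not change.\<close>
  define hc where "hc = (\<lambda>x. indicator (cbox a b) x *\<^sub>R h x)"
  have set_int: "set_integrable lebesgue (cbox a b) h"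
    using h by (simp add: locally_integrable_def)
  then have hc: "integrable lebesgue hc" by (simp add: set_integrable_def hc_def)
  have bump_cont: "continuous_on UNIV (box_bump a b n)" for n
    using test_function_box_bump[of a b n, unfolded test_function_def, THEN conjunct1, rule_format, of 0]
    by simp
  have bump_meas: "box_bump a b n \<in> borel_measurable lebesgue" for n
    by (intro measurable_completion) (use bump_cont[of n] in \<open>simp add: borel_measurable_continuous_onI\<close>)
  have ind: "indicator (box a b) x *\<^sub>R h x = indicator (box a b) x *\<^sub>R hc x" for x
    using box_subset_cbox by (auto simp: hc_def indicator_def)
  have bump: "box_bump a b n x *\<^sub>R h x = box_bump a b n x *\<^sub>R hc x" for n x
    using box_subset_cbox[of a b] box_bump_eq_0[of x a b n] by (auto simp: hc_def indicator_def)
  have "(\<lambda>n. LINT x|lebesgue. box_bump a b n x *\<^sub>R hc x)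
      \<longlonglongrightarrow> (LINT x|lebesgue. indicator (box a b) x *\<^sub>R hc x)"
  proof (rule integral_dominated_convergence[where w="\<lambda>x. norm (hc x)"])
    show "integrable lebesgue (\<lambda>x. norm (hc x))" using hc by (rule integrable_norm)
    show "(\<lambda>x. indicator (box a b) x *\<^sub>R hc x) \<in> borel_measurable lebesgue"
      using hc by (intro borel_measurable_scaleR borel_measurable_indicator) auto
    show "(\<lambda>x. box_bump a b n x *\<^sub>R hc x) \<in> borel_measurable lebesgue" for n
      using hc by (intro borel_measurable_scaleR bump_meas) auto
    show "AE x in lebesgue. (\<lambda>n. box_bump a b n x *\<^sub>R hc x) \<longlonglongrightarrow> indicator (box a b) x *\<^sub>R hc x"
      by (intro AE_I2 tendsto_scaleR box_bump_tendsto_indicator tendsto_const)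
    show "AE x in lebesgue. norm (box_bump a b n x *\<^sub>R hc x) \<le> norm (hc x)" for n
      using box_bump_bounds[of a b n] by (intro AE_I2) (simp add: mult_left_le_one_le)
  qed
  moreover have "(LINT x|lebesgue. box_bump a b n x *\<^sub>R hc x) = 0" for n
    using orth[OF test_function_box_bump[of a b n]] by (simp add: bump)
  ultimately have "(LINT x|lebesgue. indicator (box a b) x *\<^sub>R hc x) = 0"
    by (simp add: LIMSEQ_const_iff)
  then have "(LINT x:box a b|lebesgue. h x) = 0"
    by (simp add: set_lebesgue_integral_def ind)
  moreover have "set_integrable lebesgue (box a b) h"
    by (rule set_integrable_subset[OF set_int]) (auto simp: box_subset_cbox)
  ultimately have "(h has_integral 0) (box a b)"
    using has_integral_set_lebesgue by metis
  then show "(h has_integral 0) (cbox a b)" 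
    using has_integral_interior[OF negligible_convex_frontier[OF convex_box(1)[of a b]], of h 0]
    by (simp add: interior_cbox)
qed

lemma integrable_test_function_scaleR:
  fixes g :: "'a::euclidean_space \<Rightarrow> 'b::euclidean_space"
  assumes cont: "continuous_on UNIV \<phi>" and cpt: "compact (closure {x. \<phi> x \<noteq> (0::real)})"
    and g: "locally_integrable g"
  shows "integrable lebesgue (\<lambda>x. \<phi> x *\<^sub>R g x)"
proof -
  define K where "K = closure {x. \<phi> x \<noteq> 0}"
  have "compact (\<phi> ` K)"
    using cont cpt by (auto simp: K_def intro!: compact_continuous_image intro: continuous_on_subset)
  then obtain M where M: "\<And>x. x \<in> K \<Longrightarrow> \<bar>\<phi> x\<bar> \<le> M"
    by (meson bounded_real compact_imp_bounded imageI)
  have gK: "integrable lebesgue (\<lambda>x. indicator K x *\<^sub>R g x)"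
    using g cpt by (auto simp: K_def locally_integrable_def set_integrable_def)
  have eq: "\<phi> x *\<^sub>R g x = \<phi> x *\<^sub>R (indicator K x *\<^sub>R g x)" for x
    using closure_subset[of "{x. \<phi> x \<noteq> 0}"] by (auto simp: K_def indicator_def)
  have "\<phi> \<in> borel_measurable lebesgue"
    by (intro measurable_completion) (use cont in \<open>simp add: borel_measurable_continuous_onI\<close>)
  then have "(\<lambda>x. \<phi> x *\<^sub>R (indicator K x *\<^sub>R g x)) \<in> borel_measurable lebesgue"
    by (rule borel_measurable_scaleR) (rule borel_measurable_integrable[OF gK])
  then have "integrable lebesgue (\<lambda>x. \<phi> x *\<^sub>R (indicator K x *\<^sub>R g x))"
  proof (rule Bochner_Integration.integrable_bound[OF integrable_scaleR_right[OF gK, of M]])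
    show "AE x in lebesgue. norm (\<phi> x *\<^sub>R indicator K x *\<^sub>R g x) \<le> norm (M *\<^sub>R indicator K x *\<^sub>R g x)"
      using M by (intro AE_I2) (force simp: indicator_def intro!: mult_right_mono)
  qed
  then show ?thesis by (simp only: eq[symmetric])
qed

lemma has_weak_partial_unique_AE:
  fixes f :: "'a::euclidean_space \<Rightarrow> 'b::euclidean_space"
  assumes "has_weak_partial i f g" "has_weak_partial i f h"
  shows "AE x in lebesgue. g x = h x"
proof -
  have loc: "locally_integrable g" "locally_integrable h"
    using assms by (auto simp: has_weak_partial_def)
  have "AE x in lebesgue. g x - h x = 0"
  proof (rule AE_0_if_orthogonal_to_test_functions)
    show "locally_integrable (\<lambda>x. g x - h x)"
      using loc by (auto simp: locally_integrable_def intro!: set_integral_diff)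
    fix \<phi> :: "'a \<Rightarrow> real" assume \<phi>: "test_function \<phi>"
    then have "Ck 0 \<phi>" "compact (closure {x. \<phi> x \<noteq> 0})" unfolding test_function_def by blast+
    then have int: "integrable lebesgue (\<lambda>x. \<phi> x *\<^sub>R g x)" "integrable lebesgue (\<lambda>x. \<phi> x *\<^sub>R h x)"
      using loc by (auto intro: integrable_test_function_scaleR)
    have "- (LINT x|lebesgue. \<phi> x *\<^sub>R g x) = - (LINT x|lebesgue. \<phi> x *\<^sub>R h x)"
      using assms \<phi> unfolding has_weak_partial_def by metis
    then show "(LINT x|lebesgue. \<phi> x *\<^sub>R (g x - h x)) = 0"
      using int by (simp add: scaleR_diff_right)
  qed
  then show ?thesis by eventually_elim simp
qed

text \<open>This replaces the representative picked by the choice operator by any known weak derivative.\<close>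
lemma weak_partial_eq_AE:
  fixes f :: "'a::euclidean_space \<Rightarrow> 'b::euclidean_space"
  assumes "has_weak_partial i f g"
  shows "AE x in lebesgue. weak_partial i f x = g x"
  by (rule has_weak_partial_unique_AE[OF _ assms])
     (simp add: weak_partial_def someI[of "has_weak_partial i f", OF assms])

section \<open>Classical derivatives are weak derivatives\<close>
lemma derivative_eq_0_outside_support:
  fixes G :: "'a::euclidean_space \<Rightarrow> real"
  assumes der: "(G has_derivative D) (at x)"
    and "closed K" "\<And>x. x \<notin> K \<Longrightarrow> G x = 0" "x \<notin> K"
  shows "D = (\<lambda>_. 0)"
proof -
  have "(G has_derivative (\<lambda>_. 0)) (at x)"
    by (rule has_derivative_transform_within_open[of "\<lambda>_. 0" _ _ _ "- K"]) (use assms in auto)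
  then show ?thesis by (rule has_derivative_unique[OF der])
qed

text \<open>By translation invariance all difference quotients of \<open>G\<close> in direction \<open>e\<close> have integral
  zero.  The mean value theorem bounds them by the maximum of the derivative on a fixed ball, so
  dominated convergence passes this to the derivative.  This works in any Euclidean space, without
  choosing coordinates or iterating integrals.\<close>
lemma integral_partial_compact_support:
  fixes G :: "'a::euclidean_space \<Rightarrow> real"
  assumes der: "\<And>x. (G has_derivative G' x) (at x)"
    and cont: "continuous_on UNIV (\<lambda>x. G' x e)"
    and supp: "\<And>x. x \<notin> cball 0 r \<Longrightarrow> G x = 0"
  shows "(LINT x|lebesgue. G' x e) = 0"
proof -
  have G_cont: "continuous_on UNIV G"
    using der by (meson continuous_at_imp_continuous_on has_derivative_continuous)
  have supp': "G' x e = 0" if "x \<notin> cball 0 r" for x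
    using derivative_eq_0_outside_support[OF der closed_cball supp that] by simp
  have "compact ((\<lambda>x. G' x e) ` cball 0 r)"
    by (intro compact_continuous_image continuous_on_subset[OF cont]) auto
  then obtain M where M: "\<And>x. x \<in> cball 0 r \<Longrightarrow> \<bar>G' x e\<bar> \<le> M"
    by (meson bounded_real compact_imp_bounded imageI)
  then have bound: "\<bar>G' x e\<bar> \<le> \<bar>M\<bar>" for x
    using supp'[of x] by (cases "x \<in> cball 0 r") force+
  \<comment> \<open>Steps of length at most 1 keep the supports of all difference quotients in one ball.\<close>
  define t where "t n = inverse (real (Suc n))" for n
  have t: "0 < t n" "t n \<le> 1" for n by (auto simp: t_def field_simps)
  have t_lim: "t \<longlonglongrightarrow> 0" unfolding t_def by (rule LIMSEQ_inverse_real_of_nat)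
  define s where "s n x = (G (t n *\<^sub>R e + x) - G x) / t n" for n x
  have line: "((\<lambda>u. G (u *\<^sub>R e + x)) has_real_derivative G' (u *\<^sub>R e + x) e) (at u)" for u x
  proof -
    have "((\<lambda>u. G (u *\<^sub>R e + x)) has_derivative (\<lambda>h. G' (u *\<^sub>R e + x) (h *\<^sub>R e))) (at u)"
      by (rule has_derivative_compose[OF _ der]) (auto intro!: derivative_eq_intros)
    then show ?thesis
      using linear_scale[OF has_derivative_linear[OF der]]
      by (simp add: has_field_derivative_def mult.commute[of _ "G' _ e"] fun_eq_iff)
  qed
  have s_bound: "\<bar>s n x\<bar> \<le> \<bar>M\<bar> * indicator (cball 0 (r + norm e)) x" for n x
  proof (cases "x \<in> cball 0 (r + norm e)")
    case True
    obtain u where "G (t n *\<^sub>R e + x) - G (0 *\<^sub>R e + x) = (t n - 0) * G' (u *\<^sub>R e + x) e"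
      using MVT2[OF t(1)[of n], of "\<lambda>u. G (u *\<^sub>R e + x)" "\<lambda>u. G' (u *\<^sub>R e + x) e"] line by blast
    then have "s n x = G' (u *\<^sub>R e + x) e" using t(1)[of n] by (simp add: s_def)
    then show ?thesis using bound True by simp
  next
    case False
    then have "norm x > r + norm e" by simp
    moreover have "norm x \<le> norm (t n *\<^sub>R e + x) + norm (t n *\<^sub>R e)"
      by (metis add_diff_cancel_left' norm_triangle_ineq4)
    moreover have "norm (t n *\<^sub>R e) \<le> norm e"
      using t[of n] by (simp add: mult_left_le_one_le)
    ultimately have "norm (t n *\<^sub>R e + x) > r" "norm x > r"
      using norm_ge_zero[of e] by linarith+
    then show ?thesis by (simp add: s_def supp)
  qed
  have G_int: "integrable lborel G"
  proof -
    have "set_integrable lborel (cball 0 r) G"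
      unfolding set_integrable_def
      by (intro borel_integrable_compact continuous_on_subset[OF G_cont]) auto
    moreover have "(\<lambda>x. indicator (cball 0 r) x *\<^sub>R G x) = G"
      using supp by (auto simp: indicator_def fun_eq_iff)
    ultimately show ?thesis by (simp add: set_integrable_def)
  qed
  have G_meas: "G \<in> borel_measurable borel" by (intro borel_measurable_continuous_onI G_cont)
  have s_int: "(LINT x|lborel. s n x) = 0" for n
  proof -
    have "integrable (distr lborel borel ((+) (t n *\<^sub>R e))) G" using G_int by (simp add: lborel_distr_plus)
    then have "integrable lborel (\<lambda>x. G (t n *\<^sub>R e + x))"
      by (subst (asm) integrable_distr_eq) (auto simp: G_meas)
    moreover have "(LINT x|lborel. G (t n *\<^sub>R e + x)) = (LINT x|distr lborel borel ((+) (t n *\<^sub>R e)). G x)"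
      by (subst integral_distr) (auto simp: G_meas)
    ultimately show ?thesis using G_int by (simp add: s_def lborel_distr_plus)
  qed
  have "(\<lambda>n. LINT x|lborel. s n x) \<longlonglongrightarrow> (LINT x|lborel. G' x e)"
  proof (rule integral_dominated_convergence)
    show "integrable lborel (\<lambda>x. \<bar>M\<bar> * indicator (cball 0 (r + norm e)) x :: real)"
      by (intro integrable_mult_right integrable_real_indicator) (auto simp: emeasure_lborel_cball_finite[simplified])
    show "(\<lambda>x. G' x e) \<in> borel_measurable lborel"
      using cont by (simp add: borel_measurable_continuous_onI)
    show "s n \<in> borel_measurable lborel" for n
      unfolding s_def using G_meas by measurable
    show "AE x in lborel. norm (s n x) \<le> \<bar>M\<bar> * indicator (cball 0 (r + norm e)) x" for n
      using s_bound by simp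
    show "AE x in lborel. (\<lambda>n. s n x) \<longlonglongrightarrow> G' x e"
    proof (rule AE_I2)
      fix x
      have "filterlim t (at 0) sequentially"
        using t_lim t(1) by (auto simp: filterlim_at intro!: always_eventually) (metis less_irrefl)
      then show "(\<lambda>n. s n x) \<longlonglongrightarrow> G' x e"
        using filterlim_compose[OF line[of x 0, unfolded DERIV_def]] by (simp add: s_def)
    qed
  qed
  then have "(LINT x|lborel. G' x e) = 0" by (simp add: s_int LIMSEQ_const_iff)
  then show ?thesis using cont by (simp add: integral_completion borel_measurable_continuous_onI)
qed

lemma locally_integrable_continuous:
  fixes f :: "'a::euclidean_space \<Rightarrow> 'b::euclidean_space"
  assumes "continuous_on UNIV f"
  shows "locally_integrable f"
  unfolding locally_integrable_def
proof (intro allI impI)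
  fix K :: "'a set" assume K: "compact K"
  have int: "integrable lborel (\<lambda>x. indicator K x *\<^sub>R f x)"
    by (intro borel_integrable_compact continuous_on_subset[OF assms] K) auto
  then show "set_integrable lebesgue K f"
    unfolding set_integrable_def
    by (subst integrable_completion) (auto dest: borel_measurable_integrable)
qed

text \<open>Integration by parts against a test function is the vanishing of the integral of the partial
  derivative of the product, which is supported where the test function is.\<close>
lemma has_weak_partial_C1:
  fixes F :: "'a::euclidean_space \<Rightarrow> real" and c :: "'b::euclidean_space"
  assumes der: "\<And>x. (F has_derivative F' x) (at x)"
    and cont: "continuous_on UNIV (\<lambda>x. F' x i)" and i: "i \<in> Basis"
  shows "has_weak_partial i (\<lambda>x. F x *\<^sub>R c) (\<lambda>x. F' x i *\<^sub>R c)"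
  unfolding has_weak_partial_def
proof (intro conjI allI impI)
  have F_cont: "continuous_on UNIV F"
    using der by (meson continuous_at_imp_continuous_on has_derivative_continuous)
  show "locally_integrable (\<lambda>x. F x *\<^sub>R c)" "locally_integrable (\<lambda>x. F' x i *\<^sub>R c)"
    by (intro locally_integrable_continuous continuous_intros F_cont cont)+
  fix \<phi> :: "'a \<Rightarrow> real" assume \<phi>: "test_function \<phi>"
  then have cpt: "compact (closure {x. \<phi> x \<noteq> 0})" unfolding test_function_def by blast
  have "bounded (closure {x. \<phi> x \<noteq> 0})" by (rule compact_imp_bounded[OF cpt])
  then obtain r where "\<forall>x\<in>closure {x. \<phi> x \<noteq> 0}. norm x \<le> r"
    unfolding bounded_iff by (rule exE)
  then have r: "closure {x. \<phi> x \<noteq> 0} \<subseteq> cball 0 r" by (auto simp: subset_iff)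
  have "Ck (Suc 0) \<phi>" using \<phi> unfolding test_function_def by blast
  note \<phi>_der = Ck_Suc_has_derivative[OF this]
  have \<phi>'_cont: "continuous_on UNIV (\<lambda>x. frechet_derivative \<phi> (at x) i)"
    and \<phi>_cont: "continuous_on UNIV \<phi>"
    using \<open>Ck (Suc 0) \<phi>\<close> Ck_Suc_imp_Ck[of 0 \<phi>] i by simp_all
  define d\<phi> where "d\<phi> x = frechet_derivative \<phi> (at x)" for x
  have d\<phi>_supp: "{x. d\<phi> x i \<noteq> 0} \<subseteq> closure {x. \<phi> x \<noteq> 0}"
  proof (rule subsetI, rule ccontr)
    fix x assume x: "x \<in> {x. d\<phi> x i \<noteq> 0}" "x \<notin> closure {x. \<phi> x \<noteq> 0}"
    have "frechet_derivative \<phi> (at x) = (\<lambda>_. 0)"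
      by (rule derivative_eq_0_outside_support[OF \<phi>_der closed_closure _ x(2)])
         (use closure_subset[of "{x. \<phi> x \<noteq> 0}"] in blast)
    with x(1) show False by (simp add: d\<phi>_def)
  qed
  have "closure {x. d\<phi> x i \<noteq> 0} \<subseteq> closure {x. \<phi> x \<noteq> 0}"
    using d\<phi>_supp by (simp add: closure_minimal)
  then have d\<phi>_cpt: "compact (closure {x. d\<phi> x i \<noteq> 0})"
    using cpt by (meson bounded_subset closed_closure compact_eq_bounded_closed)
  have int1: "integrable lebesgue (\<lambda>x. d\<phi> x i *\<^sub>R F x)"
    by (intro integrable_test_function_scaleR d\<phi>_cpt locally_integrable_continuous F_cont)
       (use \<phi>'_cont in \<open>simp add: d\<phi>_def\<close>)
  have int2: "integrable lebesgue (\<lambda>x. \<phi> x *\<^sub>R F' x i)"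
    by (intro integrable_test_function_scaleR cpt locally_integrable_continuous \<phi>_cont cont)
  have "(LINT x|lebesgue. \<phi> x * F' x i + d\<phi> x i * F x) = 0"
  proof (rule integral_partial_compact_support[where G="\<lambda>x. \<phi> x * F x"
        and G'="\<lambda>x h. \<phi> x * F' x h + d\<phi> x h * F x"])
    show "((\<lambda>x. \<phi> x * F x) has_derivative (\<lambda>h. \<phi> x * F' x h + d\<phi> x h * F x)) (at x)" for x
      unfolding d\<phi>_def by (rule has_derivative_mult[OF \<phi>_der der])
    show "continuous_on UNIV (\<lambda>x. \<phi> x * F' x i + d\<phi> x i * F x)"
      unfolding d\<phi>_def by (intro continuous_intros \<phi>_cont cont F_cont \<phi>'_cont)
    show "\<phi> x * F x = 0" if "x \<notin> cball 0 r" for x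
      using that r closure_subset[of "{x. \<phi> x \<noteq> 0}"] by auto
  qed
  then have "(LINT x|lebesgue. d\<phi> x i * F x) = - (LINT x|lebesgue. \<phi> x * F' x i)"
    using int1 int2 by simp
  then have "(LINT x|lebesgue. (d\<phi> x i * F x) *\<^sub>R c) = - (LINT x|lebesgue. (\<phi> x * F' x i) *\<^sub>R c)"
    using int1 int2 by simp
  then show "(LINT x|lebesgue. frechet_derivative \<phi> (at x) i *\<^sub>R F x *\<^sub>R c) =
      - (LINT x|lebesgue. \<phi> x *\<^sub>R F' x i *\<^sub>R c)"
    by (simp add: d\<phi>_def)
qed

section \<open>A bound for the Sobolev norm\<close>
lemma L2_bounded_support:
  fixes f :: "'a::euclidean_space \<Rightarrow> 'b::euclidean_space"
  assumes f: "f \<in> borel_measurable lebesgue" and S: "S \<in> lmeasurable"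
    and bound: "\<And>x. norm (f x) \<le> M * indicator S x"
  shows "f \<in> L2" "(LINT x|lebesgue. (norm (f x))\<^sup>2) \<le> M\<^sup>2 * measure lebesgue S"
proof -
  have ind: "integrable lebesgue (\<lambda>x. M\<^sup>2 * indicator S x :: real)"
    using S by (intro integrable_mult_right integrable_real_indicator) (auto simp: fmeasurable_def)
  have sq: "(norm (f x))\<^sup>2 \<le> M\<^sup>2 * indicator S x" for x
    using power_mono[OF bound[of x] norm_ge_zero, of 2] by (auto simp: indicator_def)
  have int: "integrable lebesgue (\<lambda>x. (norm (f x))\<^sup>2)"
    by (rule Bochner_Integration.integrable_bound[OF ind]) (use f sq in auto)
  then show "f \<in> L2" using f by (simp add: L2_def)
  have "(LINT x|lebesgue. (norm (f x))\<^sup>2) \<le> (LINT x|lebesgue. M\<^sup>2 * indicator S x)"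
    by (rule integral_mono[OF int ind sq])
  also have "\<dots> = M\<^sup>2 * measure lebesgue S" by simp
  finally show "(LINT x|lebesgue. (norm (f x))\<^sup>2) \<le> M\<^sup>2 * measure lebesgue S" .
qed

text \<open>Uniform bounds on a function and its partial derivatives, together with a common set outside of
  which they vanish, control the Sobolev norm by the measure of that set.\<close>
lemma H1_norm_bound_C1:
  fixes F :: "'a::euclidean_space \<Rightarrow> real" and c :: "'b::euclidean_space"
  assumes der: "\<And>x. (F has_derivative F' x) (at x)"
    and cont: "\<And>i. i \<in> Basis \<Longrightarrow> continuous_on UNIV (\<lambda>x. F' x i)"
    and S: "S \<in> lmeasurable"
    and boundF: "\<And>x. \<bar>F x\<bar> \<le> A * indicator S x"
    and boundF': "\<And>x i. i \<in> Basis \<Longrightarrow> \<bar>F' x i\<bar> \<le> B * indicator S x"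
    and c: "norm c = 1"
  shows "(\<lambda>x. F x *\<^sub>R c) \<in> H1"
    and "H1_norm (\<lambda>x. F x *\<^sub>R c) \<le> sqrt ((A\<^sup>2 + real DIM('a) * B\<^sup>2) * measure lebesgue S)"
proof -
  let ?f = "\<lambda>x. F x *\<^sub>R c"
  have meas: "(\<lambda>x. u x *\<^sub>R c) \<in> borel_measurable lebesgue" if "continuous_on UNIV u" for u :: "'a \<Rightarrow> real"
    by (intro measurable_completion) (use that in \<open>simp add: borel_measurable_continuous_onI continuous_on_scaleR\<close>)
  have F_cont: "continuous_on UNIV F"
    using der by (meson continuous_at_imp_continuous_on has_derivative_continuous)
  note f = L2_bounded_support[OF meas[OF F_cont] S, of A]
  note f' = L2_bounded_support[OF meas[OF cont] S, of _ B]
  have weak: "has_weak_partial i ?f (\<lambda>x. F' x i *\<^sub>R c)" if "i \<in> Basis" for i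
    by (rule has_weak_partial_C1[OF der cont[OF that] that])
  have "\<exists>g\<in>L2. has_weak_partial i ?f g" if "i \<in> Basis" for i
    using weak[OF that] f'(1)[OF that] boundF'[OF that] c by auto
  then show "?f \<in> H1"
    using f(1) boundF c by (auto simp: H1_def)
  have "(LINT x|lebesgue. (norm (weak_partial i ?f x))\<^sup>2) \<le> B\<^sup>2 * measure lebesgue S"
    if i: "i \<in> Basis" for i
  proof -
    have ae: "AE x in lebesgue. (norm (weak_partial i ?f x))\<^sup>2 \<le> (norm (F' x i *\<^sub>R c))\<^sup>2"
      using weak_partial_eq_AE[OF weak[OF i]] by eventually_elim simp
    have "integrable lebesgue (\<lambda>x. (norm (F' x i *\<^sub>R c))\<^sup>2)"
      using f'(1)[OF i] boundF'[OF i] c by (auto simp: L2_def)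
    then have "(LINT x|lebesgue. (norm (weak_partial i ?f x))\<^sup>2) \<le> (LINT x|lebesgue. (norm (F' x i *\<^sub>R c))\<^sup>2)"
      by (rule integral_mono_AE') (use ae in auto)
    also have "\<dots> \<le> B\<^sup>2 * measure lebesgue S" using f'(2)[OF i] boundF'[OF i] c by simp
    finally show ?thesis .
  qed
  then have "(\<Sum>i\<in>Basis. LINT x|lebesgue. (norm (weak_partial i ?f x))\<^sup>2)
      \<le> real DIM('a) * (B\<^sup>2 * measure lebesgue S)"
    by (rule sum_bounded_above)
  moreover have "(LINT x|lebesgue. (norm (?f x))\<^sup>2) \<le> A\<^sup>2 * measure lebesgue S"
    using f(2) boundF c by simp
  ultimately show "H1_norm ?f \<le> sqrt ((A\<^sup>2 + real DIM('a) * B\<^sup>2) * measure lebesgue S)"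
    unfolding H1_norm_def by (intro real_sqrt_le_mono) (simp add: algebra_simps)
qed

section \<open>Volume of spherical shells\<close>
lemma power_diff_bounds:
  fixes x y :: real
  assumes "0 \<le> y" "y \<le> x"
  shows "real n * (x - y) * y ^ (n - 1) \<le> x ^ n - y ^ n"
    and "x ^ n - y ^ n \<le> real n * (x - y) * x ^ (n - 1)"
proof -
  have eq: "x ^ n - y ^ n = (x - y) * (\<Sum>k<n. y ^ (n - Suc k) * x ^ k)"
    by (rule power_diff_sumr2)
  have low: "y ^ (n - 1) \<le> y ^ (n - Suc k) * x ^ k" and up: "y ^ (n - Suc k) * x ^ k \<le> x ^ (n - 1)"
    if "k < n" for k
  proof -
    have n: "n - 1 = (n - Suc k) + k" using that by simp
    show "y ^ (n - 1) \<le> y ^ (n - Suc k) * x ^ k" "y ^ (n - Suc k) * x ^ k \<le> x ^ (n - 1)"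
      unfolding n power_add using assms
      by (auto intro!: mult_left_mono mult_right_mono power_mono)
  qed
  have "real n * y ^ (n - 1) \<le> (\<Sum>k<n. y ^ (n - Suc k) * x ^ k)"
    using sum_bounded_below[of "{..<n}", OF low] by simp
  from mult_left_mono[OF this, of "x - y"] assms
  show "real n * (x - y) * y ^ (n - 1) \<le> x ^ n - y ^ n" by (simp add: eq algebra_simps)
  have "(\<Sum>k<n. y ^ (n - Suc k) * x ^ k) \<le> real n * x ^ (n - 1)"
    using sum_bounded_above[of "{..<n}", OF up] by simp
  from mult_left_mono[OF this, of "x - y"] assms
  show "x ^ n - y ^ n \<le> real n * (x - y) * x ^ (n - 1)" by (simp add: eq algebra_simps)
qed

definition shell :: "real \<Rightarrow> real \<Rightarrow> 'a::euclidean_space set" where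
  "shell r s = cball 0 s - ball 0 r"

lemma lmeasurable_shell: "shell r s \<in> lmeasurable"
  unfolding shell_def by (intro fmeasurable.Diff) auto

text \<open>The constant \<open>\<omega>\<close> is the surface area of the unit sphere: a shell has at least its thickness times
  the area of its inner sphere, and at most its thickness times the area of its outer sphere.\<close>
lemma measure_shell_bounds:
  assumes "0 \<le> r" "r \<le> s"
  defines "\<omega> \<equiv> unit_ball_vol (real DIM('a::euclidean_space)) * real DIM('a)"
  shows "\<omega> * (s - r) * r ^ (DIM('a) - 1) \<le> measure lebesgue (shell r s :: 'a set)"
    and "measure lebesgue (shell r s :: 'a set) \<le> \<omega> * (s - r) * s ^ (DIM('a) - 1)"
proof -
  have "measure lebesgue (shell r s :: 'a set) = measure lebesgue (cball 0 s :: 'a set) - measure lebesgue (ball 0 r :: 'a set)"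
    unfolding shell_def by (rule measurable_measure_Diff) (use assms in \<open>auto simp: subset_iff\<close>)
  also have "\<dots> = unit_ball_vol (real DIM('a)) * (s ^ DIM('a) - r ^ DIM('a))"
    using assms by (simp add: content_cball content_ball algebra_simps)
  finally have eq: "measure lebesgue (shell r s :: 'a set) = unit_ball_vol (real DIM('a)) * (s ^ DIM('a) - r ^ DIM('a))" .
  show "\<omega> * (s - r) * r ^ (DIM('a) - 1) \<le> measure lebesgue (shell r s :: 'a set)"
    using mult_left_mono[OF power_diff_bounds(1)[OF assms(1,2), of "DIM('a)"], of "unit_ball_vol (real DIM('a))"]
    by (simp add: eq \<omega>_def algebra_simps)
  show "measure lebesgue (shell r s :: 'a set) \<le> \<omega> * (s - r) * s ^ (DIM('a) - 1)"
    using mult_left_mono[OF power_diff_bounds(2)[OF assms(1,2), of "DIM('a)"], of "unit_ball_vol (real DIM('a))"]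
    by (simp add: eq \<omega>_def algebra_simps)
qed

section \<open>Bumps concentrated on a shell\<close>
definition shell_bump :: "real \<Rightarrow> 'a::euclidean_space \<Rightarrow> real" where
  "shell_bump R x = flat_exp 1 (1 - ((x \<bullet> x - R\<^sup>2) / R)\<^sup>2)"

text \<open>The Frechet derivative of \<open>shell_bump R\<close> at \<open>x\<close> applied to \<open>h\<close>; the factor after the flat
  exponential is the derivative of \<open>1 - ((x \<bullet> x - R\<^sup>2) / R)\<^sup>2\<close>.\<close>
definition shell_bump' :: "real \<Rightarrow> 'a::euclidean_space \<Rightarrow> 'a \<Rightarrow> real" where
  "shell_bump' R x h = flat_exp [:0, 0, 1:] (1 - ((x \<bullet> x - R\<^sup>2) / R)\<^sup>2) *
     (- 4 * ((x \<bullet> x - R\<^sup>2) / R) * (x \<bullet> h / R))"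

lemma shell_bump_has_derivative: "(shell_bump R has_derivative shell_bump' R x) (at x)"
proof -
  have "((\<lambda>x. 1 - ((x \<bullet> x - R\<^sup>2) / R)\<^sup>2) has_derivative
     (\<lambda>h. - 4 * ((x \<bullet> x - R\<^sup>2) / R) * (x \<bullet> h / R))) (at x)"
    by (auto intro!: derivative_eq_intros simp: inner_commute fun_eq_iff algebra_simps divide_inverse)
  from has_derivative_compose[OF this flat_exp_has_derivative[of 1, unfolded has_field_derivative_def]]
  show ?thesis unfolding shell_bump_def[abs_def] shell_bump'_def[abs_def] by (simp add: pderiv_1)
qed

lemma continuous_shell_bump': "continuous_on UNIV (\<lambda>x. shell_bump' R x h)"
  unfolding shell_bump'_def divide_inverse
  by (intro continuous_intros continuous_on_compose2[OF continuous_flat_exp]) auto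

lemma flat_exp_bounded_le_1: "\<exists>C\<ge>0. \<forall>t\<le>1. \<bar>flat_exp p t\<bar> \<le> C"
proof -
  have "compact (flat_exp p ` {0..1})"
    by (intro compact_continuous_image continuous_on_subset[OF continuous_flat_exp]) auto
  then obtain C where C: "\<And>t. t \<in> {0..1} \<Longrightarrow> \<bar>flat_exp p t\<bar> \<le> C"
    by (meson bounded_real compact_imp_bounded imageI)
  have "\<bar>flat_exp p t\<bar> \<le> \<bar>C\<bar>" if "t \<le> 1" for t
    using C[of t] that by (cases "t \<ge> 0") (force simp: flat_exp_def)+
  then show ?thesis by (intro exI[of _ "\<bar>C\<bar>"]) auto
qed

text \<open>Here \<open>R\<^sup>2 - R \<ge> (R - 1)\<^sup>2\<close> because \<open>R \<ge> 1\<close>, and \<open>R\<^sup>2 + R \<le> (R + 1)\<^sup>2\<close>.\<close>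
lemma in_shell_if:
  assumes R: "R \<ge> 1" and s: "\<bar>(x \<bullet> x - R\<^sup>2) / R\<bar> < 1"
  shows "x \<in> shell (R - 1) (R + 1)"
proof -
  have "\<bar>(norm x)\<^sup>2 - R\<^sup>2\<bar> < R" using s R by (simp add: abs_divide power2_norm_eq_inner)
  then have "(R - 1)\<^sup>2 \<le> (norm x)\<^sup>2" "(norm x)\<^sup>2 \<le> (R + 1)\<^sup>2"
    using R by (simp_all add: power2_sum power2_diff abs_less_iff)
  then have "R - 1 \<le> norm x" "norm x \<le> R + 1"
    using R by (meson norm_ge_zero power2_le_imp_le, meson add_nonneg_nonneg order_trans power2_le_imp_le zero_le_one)
  then show ?thesis by (simp add: shell_def)
qed

lemma flat_exp_1_minus_sq_eq_0: "\<not> \<bar>s\<bar> < 1 \<Longrightarrow> flat_exp p (1 - s\<^sup>2) = 0"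
  by (auto simp: flat_exp_def abs_square_less_1)

lemma shell_bump_bound:
  assumes R: "R \<ge> 1"
  shows "\<bar>shell_bump R x\<bar> \<le> 1 * indicator (shell (R - 1) (R + 1)) x"
proof (cases "\<bar>(x \<bullet> x - R\<^sup>2) / R\<bar> < 1")
  case True
  then show ?thesis using in_shell_if[OF R True] flat_exp_1_bounds by (simp add: shell_bump_def)
next
  case False
  then show ?thesis by (simp add: shell_bump_def flat_exp_1_minus_sq_eq_0 del: abs_divide)
qed

text \<open>The factor \<open>x \<bullet> h / R\<close> does not grow with \<open>R\<close> since \<open>|x| \<le> R + 1 \<le> 2 * R\<close> on the shell.  The
  constant is \<open>4 * 1 * 2\<close> times a bound for the flat exponential, independent of \<open>R\<close>.\<close>
lemma shell_bump'_bound: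
  assumes R: "R \<ge> 1" and C: "\<And>t. t \<le> 1 \<Longrightarrow> \<bar>flat_exp [:0, 0, 1:] t\<bar> \<le> C" and i: "i \<in> Basis"
  shows "\<bar>shell_bump' R x i\<bar> \<le> (8 * C) * indicator (shell (R - 1) (R + 1)) x"
proof (cases "\<bar>(x \<bullet> x - R\<^sup>2) / R\<bar> < 1")
  case True
  define s where "s = (x \<bullet> x - R\<^sup>2) / R"
  have s: "\<bar>s\<bar> \<le> 1" using True by (simp add: s_def)
  have in_shell: "x \<in> shell (R - 1) (R + 1)" by (rule in_shell_if[OF R True])
  have "\<bar>x \<bullet> i\<bar> \<le> norm x" using Basis_le_norm[OF i] .
  also have "\<dots> \<le> 2 * R" using in_shell R by (simp add: shell_def)
  finally have xi: "\<bar>x \<bullet> i / R\<bar> \<le> 2" using R by (simp add: field_simps)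
  have "\<bar>shell_bump' R x i\<bar> = \<bar>flat_exp [:0, 0, 1:] (1 - s\<^sup>2)\<bar> * (4 * \<bar>s\<bar> * \<bar>x \<bullet> i / R\<bar>)"
    unfolding shell_bump'_def s_def[symmetric] by (simp add: abs_mult)
  also have "\<dots> \<le> C * (4 * 1 * 2)"
    by (intro mult_mono C xi s) (auto intro: order_trans[OF abs_ge_zero C[of 1]])
  finally show ?thesis using in_shell by simp
next
  case False
  have "0 \<le> C" by (rule order_trans[OF abs_ge_zero C[of 1]]) simp
  then show ?thesis using False by (simp add: shell_bump'_def flat_exp_1_minus_sq_eq_0 del: abs_divide)
qed

text \<open>The thickness \<open>1/8\<close> is small enough for \<open>s = (|x|\<^sup>2 - R\<^sup>2) / R\<close> to satisfy \<open>0 \<le> s \<le> 1/2\<close>;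
  then \<open>1 - s\<^sup>2 \<ge> 3/4\<close>, whence the exponent \<open>- 4/3\<close>.\<close>
lemma shell_bump_lower_bound:
  assumes R: "R \<ge> 1" and x: "x \<in> shell R (R + 1/8)"
  shows "exp (- (4/3)) \<le> shell_bump R x"
proof -
  define s where "s = (x \<bullet> x - R\<^sup>2) / R"
  have n: "R \<le> norm x" "norm x \<le> R + 1/8" using x by (auto simp: shell_def)
  have "R\<^sup>2 \<le> (norm x)\<^sup>2" "(norm x)\<^sup>2 \<le> (R + 1/8)\<^sup>2" using n R by (auto intro: power_mono)
  moreover have "(R + 1/8)\<^sup>2 \<le> R\<^sup>2 + R / 2" using R by (simp add: power2_eq_square algebra_simps)
  ultimately have "0 \<le> s" "s \<le> 1/2" using R by (auto simp: s_def power2_norm_eq_inner field_simps)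
  then have "s\<^sup>2 \<le> (1/2)\<^sup>2" by (intro power_mono) auto
  then have "3/4 \<le> 1 - s\<^sup>2" by (simp add: power2_eq_square)
  then have "1 / (1 - s\<^sup>2) \<le> 4/3" and "0 < 1 - s\<^sup>2" by (simp_all add: field_simps)
  then show ?thesis by (simp add: shell_bump_def s_def[symmetric] flat_exp_def del: power_divide)
qed

section \<open>Growth of the quotient\<close>
lemma shell_bump_weighted_integral_lower_bound:
  fixes c :: "'b::real_normed_vector"
  assumes R: "R \<ge> 1" and b: "b \<ge> 0" and q: "q \<ge> 0" and c: "norm c = 1"
  shows "ennreal (R powr b * exp (- (4/3)) powr q * measure lebesgue (shell R (R + 1/8) :: 'a set))
    \<le> (\<integral>\<^sup>+x. ennreal (norm x powr b * norm (shell_bump R x *\<^sub>R c) powr q) \<partial>(lebesgue :: 'a::euclidean_space measure))"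
proof -
  define S where "S = (shell R (R + 1/8) :: 'a set)"
  have S: "S \<in> lmeasurable" unfolding S_def by (rule lmeasurable_shell)
  have "ennreal (R powr b * exp (- (4/3)) powr q * measure lebesgue S) =
      ennreal (R powr b * exp (- (4/3)) powr q) * emeasure lebesgue S"
    using S by (simp add: ennreal_mult emeasure_eq_measure2)
  also have "\<dots> = (\<integral>\<^sup>+x. ennreal (R powr b * exp (- (4/3)) powr q) * indicator S x \<partial>lebesgue)"
    using S by (intro nn_integral_cmult_indicator[symmetric]) auto
  also have "\<dots> \<le> (\<integral>\<^sup>+x. ennreal (norm x powr b * norm (shell_bump R x *\<^sub>R c) powr q) \<partial>(lebesgue :: 'a measure))"
  proof (rule nn_integral_mono)
    fix x :: 'a
    show "ennreal (R powr b * exp (- (4/3)) powr q) * indicator S x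
       \<le> ennreal (norm x powr b * norm (shell_bump R x *\<^sub>R c) powr q)"
    proof (cases "x \<in> S")
      case True
      have "R \<le> norm x" using True by (simp add: S_def shell_def)
      moreover have "exp (- (4/3)) \<le> norm (shell_bump R x *\<^sub>R c)"
        using shell_bump_lower_bound[OF R, of x] True c by (simp add: S_def)
      ultimately show ?thesis
        using True R b q by (auto intro!: ennreal_leI mult_mono powr_mono2)
    qed simp
  qed
  finally show ?thesis unfolding S_def .
qed

lemma inverse_ennreal_antimono:
  assumes "0 \<le> x" "x \<le> y"
  shows "inverse (ennreal y) \<le> inverse (ennreal x)"
proof (cases "x = 0")
  case False
  then show ?thesis using assms by (simp add: inverse_ennreal ennreal_leI le_imp_inverse_le)
qed simp

text \<open>The shell estimates bound the numerator below by \<open>A * R powr (b + d)\<close> and the squared Sobolev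
  norm above by \<open>B * R powr d\<close>, where \<open>d\<close> is one less than the dimension.  Taking the power
  \<open>(p + 1) / 2\<close> of the latter leaves the stated exponent of \<open>R\<close>.\<close>
lemma shell_bump_quotient_lower_bound:
  fixes b p :: real
  assumes "b > 0" "p > 1"
  shows "\<exists>K>0. \<forall>R\<ge>1. (\<lambda>x::'a::euclidean_space. shell_bump R x *\<^sub>R (1::'k)) \<in> H1 \<and>
    \<not> (AE x in (lebesgue :: 'a measure). shell_bump R x *\<^sub>R (1::'k) = 0) \<and>
    ennreal (K * R powr (b - (real DIM('a) - 1) * (p - 1) / 2)) \<le>
      (\<integral>\<^sup>+x. ennreal (norm x powr b * norm (shell_bump R x *\<^sub>R (1::'k)) powr (p + 1)) \<partial>(lebesgue :: 'a measure))
       / ennreal (H1_norm (\<lambda>x::'a. shell_bump R x *\<^sub>R (1::'k::{real_normed_field, euclidean_space})) powr (p + 1))"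
proof -
  obtain C where C: "\<And>t. t \<le> 1 \<Longrightarrow> \<bar>flat_exp [:0, 0, 1:] t\<bar> \<le> C"
    using flat_exp_bounded_le_1 by metis
  define d where "d = real DIM('a) - 1"
  have d: "d = real (DIM('a) - 1)" using DIM_positive[where 'a='a] by (simp add: d_def of_nat_diff)
  define \<omega> where "\<omega> = unit_ball_vol (real DIM('a)) * real DIM('a)"
  have \<omega>: "\<omega> > 0" unfolding \<omega>_def by (intro mult_pos_pos) auto
  define A where "A = exp (- (4/3)) powr (p + 1) * (\<omega> / 8)"
  define B where "B = (1 + real DIM('a) * (8 * C)\<^sup>2) * (\<omega> * 2 * 2 ^ (DIM('a) - 1))"
  have A: "A > 0" using \<omega> by (simp add: A_def)
  have B: "B > 0" unfolding B_def using \<omega> by (intro mult_pos_pos add_pos_nonneg) auto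
  define K where "K = A / B powr ((p + 1) / 2)"
  have K: "K > 0" using A B by (simp add: K_def)
  have "(\<lambda>x::'a. shell_bump R x *\<^sub>R (1::'k)) \<in> H1 \<and>
    \<not> (AE x in (lebesgue :: 'a measure). shell_bump R x *\<^sub>R (1::'k) = 0) \<and>
    ennreal (K * R powr (b - d * (p - 1) / 2)) \<le>
      (\<integral>\<^sup>+x. ennreal (norm x powr b * norm (shell_bump R x *\<^sub>R (1::'k)) powr (p + 1)) \<partial>(lebesgue :: 'a measure))
       / ennreal (H1_norm (\<lambda>x::'a. shell_bump R x *\<^sub>R (1::'k)) powr (p + 1))"
    if R: "R \<ge> 1" for R
  proof (intro conjI)
    let ?f = "\<lambda>x::'a. shell_bump R x *\<^sub>R (1::'k)"
    let ?num = "\<integral>\<^sup>+x. ennreal (norm x powr b * norm (?f x) powr (p + 1)) \<partial>lebesgue"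
    let ?S = "shell (R - 1) (R + 1) :: 'a set"
    have R0: "R > 0" using R by simp
    have pow: "R ^ (DIM('a) - 1) = R powr d" unfolding d by (rule powr_realpow[OF R0, symmetric])
    note H = H1_norm_bound_C1[OF shell_bump_has_derivative continuous_shell_bump' lmeasurable_shell
        shell_bump_bound[OF R] shell_bump'_bound[OF R C], of "1::'k"]
    show "?f \<in> H1" by (rule H(1)) auto
    have "ennreal (A * R powr (b + d)) \<le>
        ennreal (R powr b * exp (- (4/3)) powr (p + 1) * measure lebesgue (shell R (R + 1/8) :: 'a set))"
    proof (rule ennreal_leI)
      have "\<omega> / 8 * R powr d \<le> measure lebesgue (shell R (R + 1/8) :: 'a set)"
        using measure_shell_bounds(1)[of R "R + 1/8", where 'a='a] R0 by (simp add: \<omega>_def pow[symmetric])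
      then have "(R powr b * exp (- (4/3)) powr (p + 1)) * (\<omega> / 8 * R powr d) \<le>
         (R powr b * exp (- (4/3)) powr (p + 1)) * measure lebesgue (shell R (R + 1/8) :: 'a set)"
        by (intro mult_left_mono) auto
      then show "A * R powr (b + d) \<le> R powr b * exp (- (4/3)) powr (p + 1) * measure lebesgue (shell R (R + 1/8) :: 'a set)"
        by (simp add: A_def powr_add mult_ac)
    qed
    also have "\<dots> \<le> ?num"
      using shell_bump_weighted_integral_lower_bound[OF R, of b "p + 1" "1::'k", where 'a='a] assms by simp
    finally have num: "ennreal (A * R powr (b + d)) \<le> ?num" .
    show "\<not> (AE x in lebesgue. ?f x = 0)"
    proof
      assume "AE x in lebesgue. ?f x = 0"
      then have "AE x in lebesgue. ennreal (norm x powr b * norm (?f x) powr (p + 1)) = 0"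
        by eventually_elim (simp only: norm_zero powr_0 mult_zero_right ennreal_0)
      then have "?num = 0" by (subst nn_integral_cong_AE) auto
      moreover have "A * R powr (b + d) > 0" using A R0 by simp
      ultimately show False using num by (simp add: ennreal_eq_0_iff)
    qed
    have "measure lebesgue ?S \<le> \<omega> * 2 * (R + 1) ^ (DIM('a) - 1)"
      using measure_shell_bounds(2)[of "R - 1" "R + 1", where 'a='a] R by (simp add: \<omega>_def)
    also have "\<dots> \<le> \<omega> * 2 * (2 * R) ^ (DIM('a) - 1)"
      using R \<omega> by (intro mult_left_mono power_mono) auto
    finally have S: "measure lebesgue ?S \<le> \<omega> * 2 * 2 ^ (DIM('a) - 1) * R powr d"
      by (simp add: power_mult_distrib pow[symmetric] mult_ac)
    have "H1_norm ?f \<le> sqrt ((1\<^sup>2 + real DIM('a) * (8 * C)\<^sup>2) * measure lebesgue ?S)"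
      by (rule H(2)) auto
    also have "\<dots> \<le> sqrt (B * R powr d)"
      using mult_left_mono[OF S, of "1 + real DIM('a) * (8 * C)\<^sup>2"] by (simp add: B_def mult_ac)
    finally have "H1_norm ?f \<le> (B * R powr d) powr (1/2)" using B by (simp add: powr_half_sqrt)
    moreover have "0 \<le> H1_norm ?f" unfolding H1_norm_def by (auto intro!: add_nonneg_nonneg sum_nonneg)
    ultimately have "H1_norm ?f powr (p + 1) \<le> ((B * R powr d) powr (1/2)) powr (p + 1)"
      using assms by (intro powr_mono2) auto
    also have "\<dots> = B powr ((p + 1) / 2) * R powr (d * ((p + 1) / 2))"
      using B R0 by (simp add: powr_powr powr_mult)
    finally have den: "H1_norm ?f powr (p + 1) \<le> B powr ((p + 1) / 2) * R powr (d * ((p + 1) / 2))" .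
    have exponent: "R powr (b + d) / R powr (d * ((p + 1) / 2)) = R powr (b - d * (p - 1) / 2)"
      by (simp add: powr_diff[symmetric]) (simp add: diff_divide_distrib add_divide_distrib algebra_simps)
    have "K * R powr (b - d * (p - 1) / 2)
        = (A * R powr (b + d)) / (B powr ((p + 1) / 2) * R powr (d * ((p + 1) / 2)))"
      unfolding K_def exponent[symmetric] by (rule times_divide_times_eq)
    then have "ennreal (K * R powr (b - d * (p - 1) / 2)) =
       ennreal (A * R powr (b + d)) / ennreal (B powr ((p + 1) / 2) * R powr (d * ((p + 1) / 2)))"
      using A B R0 by (simp add: divide_ennreal)
    also have "\<dots> \<le> ?num / ennreal (H1_norm ?f powr (p + 1))"
      unfolding divide_ennreal_def by (intro mult_mono num inverse_ennreal_antimono den) auto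
    finally show "ennreal (K * R powr (b - d * (p - 1) / 2)) \<le> ?num / ennreal (H1_norm ?f powr (p + 1))" .
  qed
  then show ?thesis using K unfolding d_def by blast
qed

theorem lemma2p5:
  fixes b p :: real
  assumes "DIM('a::euclidean_space) \<ge> 2"
    and "b > 0"
    and "1 < p"
    and "p < 1 + 2 * b / (real DIM('a) - 1)"
  shows "(SUP f \<in> {f \<in> (H1 :: ('a \<Rightarrow> 'k::{real_normed_field, euclidean_space}) set).
                     \<not> (AE x in lebesgue. f x = 0)}.
            (\<integral>\<^sup>+x. ennreal (norm x powr b * norm (f x) powr (p + 1)) \<partial>lebesgue)
              / ennreal (H1_norm f powr (p + 1))) = \<infinity>"
proof -
  define e where "e = b - (real DIM('a) - 1) * (p - 1) / 2"
  have e: "e > 0" using assms by (simp add: e_def field_simps)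
  obtain K where "K > 0" and K: "\<And>R. R \<ge> 1 \<Longrightarrow> (\<lambda>x::'a. shell_bump R x *\<^sub>R (1::'k)) \<in> H1 \<and>
    \<not> (AE x in (lebesgue :: 'a measure). shell_bump R x *\<^sub>R (1::'k) = 0) \<and>
    ennreal (K * R powr e) \<le>
      (\<integral>\<^sup>+x. ennreal (norm x powr b * norm (shell_bump R x *\<^sub>R (1::'k)) powr (p + 1)) \<partial>(lebesgue :: 'a measure))
       / ennreal (H1_norm (\<lambda>x::'a. shell_bump R x *\<^sub>R (1::'k)) powr (p + 1))"
    using shell_bump_quotient_lower_bound[OF assms(2,3), where 'a='a and 'k='k] unfolding e_def by blast
  have large: "\<exists>R\<ge>1. M < K * R powr e" for M
  proof -
    define X where "X = max 1 ((\<bar>M\<bar> + 1) / K)"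
    have "(\<bar>M\<bar> + 1) / K \<le> X" by (simp add: X_def)
    then have "M < K * X" using \<open>K > 0\<close> by (simp add: field_simps)
    moreover have "X \<ge> 1" by (simp add: X_def)
    ultimately show ?thesis
      using e by (intro exI[of _ "X powr (1 / e)"]) (simp add: powr_powr ge_one_powr_ge_zero)
  qed
  show ?thesis
    unfolding infinity_ennreal_def SUP_eq_top_iff
  proof (intro allI impI)
    fix y :: ennreal assume "y < top"
    then obtain M where M: "y = ennreal M" "M \<ge> 0" by (cases y) auto
    obtain R where R: "R \<ge> 1" "M < K * R powr e" using large by blast
    have "y < ennreal (K * R powr e)" using M R by (simp add: ennreal_lessI)
    also note K[OF R(1), THEN conjunct2, THEN conjunct2]
    finally show "\<exists>f\<in>{f \<in> (H1 :: ('a \<Rightarrow> 'k) set). \<not> (AE x in lebesgue. f x = 0)}.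
      y < (\<integral>\<^sup>+x. ennreal (norm x powr b * norm (f x) powr (p + 1)) \<partial>lebesgue)
              / ennreal (H1_norm f powr (p + 1))"
      by (rule bexI[where x="\<lambda>x. shell_bump R x *\<^sub>R 1"]) (intro CollectI conjI K[OF R(1), THEN conjunct1] K[OF R(1), THEN conjunct2, THEN conjunct1])
  qed
qed

end
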